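(* Let $\mathbb{F}$ be a field, let $V$ be an infinite-dimensional vector space over $\mathbb{F}$, and let $u$ be an endomorphism of $V$ with no dominant eigenvalue. Let $p_1,p_2,p_3\in\mathbb{F}[t]$ be split polynomials of degree $2$. Then $u$ is a $(p_1,p_2,p_3)$-sum.
   Context: For an endomorphism $u$ of an infinite-dimensional vector space $V$, a scalar $\lambda\in\mathbb{F}$ is a dominant eigenvalue of $u$ if $\operatorname{rk}(u-\lambda\,\mathrm{id}_V)<\dim V$. Given polynomials $p_1,\dots,p_n$, an endomorphism $u$ of $V$ is a $(p_1,\dots,p_n)$-sum if there exist endomorphisms $u_1,\dots,u_n$ of $V$ with $u=\sum_{k=1}^n u_k$ and $p_k(u_k)=0$ for all $k$. *)

theory Defs
  imports "HOL-Computational_Algebra.Polynomial" "HOL-Library.Equipollence"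
begin

text \<open>Vector spaces are given as in HOL's Vector_Spaces: a type 'v of vectors
with an abelian group structure and a scalar multiplication
scale :: 'f \<Rightarrow> 'v \<Rightarrow> 'v over a field 'f satisfying vector_space scale.
Endomorphisms are linear maps Vector_Spaces.linear scale scale u.\<close>

definition basis_of :: "('f::field \<Rightarrow> 'v::ab_group_add \<Rightarrow> 'v) \<Rightarrow> 'v set \<Rightarrow> 'v set \<Rightarrow> bool" where
  "basis_of scale S B \<longleftrightarrow> \<not> module.dependent scale B \<and> module.span scale B = S"

definition dim_less :: "('f::field \<Rightarrow> 'v::ab_group_add \<Rightarrow> 'v) \<Rightarrow> 'v set \<Rightarrow> 'v set \<Rightarrow> bool" where
  "dim_less scale S T \<longleftrightarrow> (\<exists>B C. basis_of scale S B \<and> basis_of scale T C \<and> B \<prec> C)"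

definition infinite_dimensional :: "('f::field \<Rightarrow> 'v::ab_group_add \<Rightarrow> 'v) \<Rightarrow> bool" where
  "infinite_dimensional scale \<longleftrightarrow> \<not> (\<exists>B. finite B \<and> module.span scale B = UNIV)"

definition dominant_eigenvalue :: "('f::field \<Rightarrow> 'v::ab_group_add \<Rightarrow> 'v) \<Rightarrow> ('v \<Rightarrow> 'v) \<Rightarrow> 'f \<Rightarrow> bool" where
  "dominant_eigenvalue scale u lam \<longleftrightarrow>
     dim_less scale (range (\<lambda>v. u v - scale lam v)) UNIV"

definition poly_endo :: "('f::field \<Rightarrow> 'v::ab_group_add \<Rightarrow> 'v) \<Rightarrow> 'f poly \<Rightarrow> ('v \<Rightarrow> 'v) \<Rightarrow> 'v \<Rightarrow> 'v" where
  "poly_endo scale p f v = (\<Sum>i\<le>degree p. scale (coeff p i) ((f ^^ i) v))"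

definition split_deg2 :: "'f::field poly \<Rightarrow> bool" where
  "split_deg2 p \<longleftrightarrow> degree p = 2 \<and>
     (\<exists>a b. p = smult (lead_coeff p) ([:-a, 1:] * [:-b, 1:]))"

definition is_poly_sum :: "('f::field \<Rightarrow> 'v::ab_group_add \<Rightarrow> 'v) \<Rightarrow> 'f poly list \<Rightarrow> ('v \<Rightarrow> 'v) \<Rightarrow> bool" where
  "is_poly_sum scale ps u \<longleftrightarrow>
     (\<exists>us :: ('v \<Rightarrow> 'v) list. length us = length ps \<and>
        (\<forall>k<length ps. Vector_Spaces.linear scale scale (us ! k) \<and> (\<forall>v. poly_endo scale (ps ! k) (us ! k) v = 0)) \<and>
        (\<forall>v. u v = (\<Sum>k<length ps. (us ! k) v)))"

end

theory Submission
  imports Defs "HOL-Library.Countable_Set"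
begin

text \<open>Write \<open>l\<^sub>k, m\<^sub>k\<close> for the roots of \<open>p\<^sub>k\<close> and \<open>\<sigma>\<close> for the sum of all six. Suppose \<open>V = V\<^sub>1 \<oplus> V\<^sub>2\<close> with bases
\<open>(b\<^sub>z)\<close> of \<open>V\<^sub>1\<close> and \<open>(d\<^sub>z)\<close> of \<open>V\<^sub>2\<close> over the same index set, such that the diagonal blocks of \<open>u\<close> are
\<open>\<sigma> - S\<close> and \<open>S\<close> for the same operator \<open>S\<close>. Then a suitable \<open>w\<^sub>3\<close> with \<open>p\<^sub>3(w\<^sub>3) = 0\<close> can be subtracted to
make the diagonal blocks of \<open>u\<close> equal to the scalars \<open>l\<^sub>1 + l\<^sub>2\<close> and \<open>m\<^sub>1 + m\<^sub>2\<close>, and what is left is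
the sum of a block upper and a block lower triangular matrix with diagonals \<open>(l\<^sub>1, m\<^sub>1)\<close> and \<open>(l\<^sub>2, m\<^sub>2)\<close>,
whatever the off-diagonal blocks are.

Such a decomposition exists with \<open>S\<close> a shift \<open>z \<mapsto> \<pi> z\<close>. As no eigenvalue is dominant, there is a set
\<open>X\<close> of cardinality \<open>dim V\<close> for which \<open>X\<close> and \<open>u X\<close> are jointly independent; complete them by \<open>G\<close> to a
basis. Take \<open>V\<^sub>1 = span X\<close> and let \<open>V\<^sub>2\<close> be spanned by the vectors \<open>u x + \<pi> x\<close> and \<open>g + \<pi> g\<close> for an
injection \<open>\<pi>\<close> of \<open>X \<union> G\<close> into \<open>X\<close>. If \<open>\<pi> z\<close> lies far enough beyond \<open>z\<close> in a well-founded order, both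
diagonal blocks are, up to lower terms, given by \<open>\<pi>\<close>, and the lower terms disappear after a
unitriangular change of basis.\<close>

subsection \<open>A successor function dominating given finite supports\<close>

text \<open>Enumerate \<open>A\<close> along the partial sums of \<open>Suc (B k)\<close>. These
  increase strictly and exceed \<open>B n\<close>, and the element of \<open>A\<close> with number
  k, counted from 0, is at least k.\<close>

lemma strict_mono_in_infinite_set_above:
  fixes A :: "nat set" and B :: "nat \<Rightarrow> nat"
  assumes "infinite A"
  obtains f where "strict_mono f" "\<And>n. f n \<in> A" "\<And>n. B n < f n"
proof
  define g where "g n = (\<Sum>k\<le>n. Suc (B k))" for n
  have "strict_mono g"
    by (auto simp: strict_mono_Suc_iff g_def)
  then show "strict_mono (\<lambda>n. enumerate A (g n))"
    using assms by (simp add: strict_mono_def)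
  show "enumerate A (g n) \<in> A" for n
    using assms by (rule enumerate_in_set)
  have "B n < g n" for n
    by (cases n) (auto simp: g_def)
  also have "g n \<le> enumerate A (g n)" for n
    using assms by (rule le_enumerate)
  finally show "B n < enumerate A (g n)" for n .
qed

text \<open>The value at i is the least m, in some well-order, from which i is reachable.\<close>

lemma ex_monotone_on_reachability:
  fixes step :: "'a rel"
  assumes step: "\<And>i. countable (step `` {i})"
  obtains blk :: "'a \<Rightarrow> 'a" and s :: "'a rel"
    where "wf s" "trans s" "total s"
      "\<And>i j. (i, j) \<in> step \<Longrightarrow> blk j = blk i \<or> (blk j, blk i) \<in> s"
      "\<And>m. countable {i. blk i = m}"
proof -
  obtain r :: "'a rel" where r: "Well_order r" "Field r = UNIV"
    using well_ordering[where 'a = 'a] by (elim exE conjE)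
  define s where "s = r - Id"
  have wf: "wf s"
    using r by (simp add: s_def well_order_on_def)
  have "Linear_order r"
    using r by (simp add: well_order_on_def)
  then have "trans s" and total: "total s"
    using r(2) by (simp_all add: s_def order_on_defs trans_diff_Id)
  \<comment> \<open>All points from which \<open>i\<close> is reachable, \<open>i\<close> included.
    A step from \<open>i\<close> to \<open>j\<close> enlarges this set, so its minimum can only
    drop.\<close>
  define S where "S i = {k. (k, i) \<in> step\<^sup>*}" for i
  have "\<exists>m\<in>S i. \<forall>y. (y, m) \<in> s \<longrightarrow> y \<notin> S i" for i
    using wf[THEN wfE_min, of i "S i"] by (auto simp: S_def)
  then obtain blk where blk: "\<And>i. blk i \<in> S i" "\<And>i y. (y, blk i) \<in> s \<Longrightarrow> y \<notin> S i"
    by metis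
  have le: "blk j = blk i \<or> (blk j, blk i) \<in> s" if "(i, j) \<in> step" for i j
  proof -
    have "S i \<subseteq> S j"
      using that by (auto simp: S_def)
    then have "(blk i, blk j) \<notin> s"
      using blk by blast
    then show ?thesis
      using total by (auto simp: total_on_def)
  qed
  have "countable (step `` Y)" if "countable Y" for Y
  proof -
    have "step `` Y = (\<Union>i\<in>Y. step `` {i})" by auto
    then show ?thesis using that step by simp
  qed
  then have "countable (step\<^sup>* `` {m})" for m
    by (intro countable_rtrancl) auto
  \<comment> \<open>Since \<open>blk i\<close> lies in \<open>S i\<close>, every \<open>i\<close>
    with \<open>blk i = m\<close> is reachable from \<open>m\<close>.\<close>
  moreover have "{i. blk i = m} \<subseteq> step\<^sup>* `` {m}" for m
    using blk(1) by (auto simp: S_def)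
  ultimately have "countable {i. blk i = m}" for m
    using countable_subset by blast
  with that wf \<open>trans s\<close> total le show ?thesis by blast
qed

text \<open>The order is lexicographic: first by blocks of the closure under supports, then, inside a countable
block, by an enumeration. Cofinality of the cardinal of X is thus never an issue.\<close>

lemma ex_dominating_successor:
  fixes X G :: "'a set" and supp :: "'a \<Rightarrow> 'a set"
  assumes X: "infinite X" and G: "G \<lesssim> X"
    and supp: "\<And>z. z \<in> X \<union> G \<Longrightarrow> finite (supp z) \<and> supp z \<subseteq> X \<union> G"
  obtains R :: "'a rel" and \<pi> :: "'a \<Rightarrow> 'a"
    where "wf R" "trans R" "total_on (X \<union> G) R" "\<pi> ` (X \<union> G) \<subseteq> X"
      "\<And>z. z \<in> X \<union> G \<Longrightarrow> insert z (supp z) \<subseteq> R\<inverse> `` {\<pi> z}"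
      "\<And>z w. z \<in> X \<union> G \<Longrightarrow> w \<in> X \<union> G \<Longrightarrow> (z, w) \<in> R \<Longrightarrow> (\<pi> z, \<pi> w) \<in> R"
proof -
  let ?Z = "X \<union> G"
  \<comment> \<open>The first coordinate of such a bijection cuts \<open>X\<close> into countably
    infinite fibres.\<close>
  have "X \<times> (UNIV :: nat set) \<approx> X"
    using X by (simp add: eqpoll_iff_card_of_ordIso card_of_Times_infinite infinite_iff_card_of_nat)
  then obtain h where h: "bij_betw h X (X \<times> (UNIV :: nat set))"
    using eqpoll_sym by (auto simp: eqpoll_def)
  obtain \<gamma> where \<gamma>: "inj_on \<gamma> G" "\<gamma> ` G \<subseteq> X"
    using G by (auto simp: lepoll_def)
  \<comment> \<open>Every fibre of the address map is countable and contains infinitely many elements of X.\<close>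
  define a where "a z = (if z \<in> X then fst (h z) else \<gamma> z)" for z
  have count_a: "countable {z \<in> ?Z. a z = i}" for i
  proof -
    have "x \<in> inv_into X h ` ({fst (h x)} \<times> UNIV)" if "x \<in> X" for x
      using that h by (intro image_eqI[of _ _ "h x"]) (auto simp: bij_betw_def mem_Times_iff)
    then have "{z \<in> ?Z. a z = i} \<subseteq> inv_into X h ` ({i} \<times> UNIV) \<union> {g \<in> G. \<gamma> g = i}"
      by (auto simp: a_def)
    moreover have "finite {g \<in> G. \<gamma> g = i}"
      using finite_vimage_IntI[OF _ \<gamma>(1), of "{i}"] by (simp add: vimage_def Int_def conj_commute)
    ultimately show ?thesis
      by (meson countable_SIGMA countable_Un countableI_type countable_finite countable_image
          countable_subset finite.intros)
  qed
  have inf_a: "infinite {x \<in> X. a x = a z}" if "z \<in> ?Z" for z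
  proof -
    have "a z \<in> X"
      using that \<gamma>(2) bij_betwE[OF h] by (fastforce simp: a_def mem_Times_iff)
    then have "inv_into X h ` ({a z} \<times> UNIV) \<subseteq> {x \<in> X. a x = a z}"
      using h by (auto simp: a_def bij_betw_def f_inv_into_f inv_into_into)
    moreover have "inj_on (inv_into X h) ({a z} \<times> UNIV)"
      using h \<open>a z \<in> X\<close> by (auto simp: bij_betw_def intro!: inj_on_inv_into)
    then have "infinite (inv_into X h ` ({a z} \<times> (UNIV :: nat set)))"
      by (simp add: finite_image_iff finite_cartesian_product_iff)
    ultimately show ?thesis
      using finite_subset by blast
  qed
  \<comment> \<open>Supports are transferred to addresses, so that a block is a union of whole
    address fibres. A nonempty block therefore meets \<open>X\<close> in an infinite set.\<close>
  define step where "step = {(a z, a w) | z w. z \<in> ?Z \<and> w \<in> supp z}"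
  have count_step: "countable (step `` {i})" for i
  proof -
    have "step `` {i} = a ` (\<Union>z\<in>{z \<in> ?Z. a z = i}. supp z)"
      by (auto simp: step_def)
    moreover have "countable (a ` (\<Union>z\<in>{z \<in> ?Z. a z = i}. supp z))"
      using count_a[of i] supp by (auto intro!: countable_image countable_UN intro: countable_finite)
    ultimately show ?thesis by simp
  qed
  obtain blk :: "'a \<Rightarrow> 'a" and s :: "'a rel" where s: "wf s" "trans s" "total s"
    and blk_step: "\<And>i j. (i, j) \<in> step \<Longrightarrow> blk j = blk i \<or> (blk j, blk i) \<in> s"
    and blk_count: "\<And>m. countable {i. blk i = m}"
    by (rule ex_monotone_on_reachability[OF count_step]) (rule that; assumption)
  define \<beta> where "\<beta> z = blk (a z)" for z
  have \<beta>_supp: "\<beta> w = \<beta> z \<or> (\<beta> w, \<beta> z) \<in> s" if "z \<in> ?Z" "w \<in> supp z" for z w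
    using blk_step[of "a z" "a w"] that by (auto simp: step_def \<beta>_def)
  define D where "D m = {z \<in> ?Z. \<beta> z = m}" for m
  have "countable (D m)" for m
  proof -
    have "D m = (\<Union>i\<in>{i. blk i = m}. {z \<in> ?Z. a z = i})"
      by (auto simp: D_def \<beta>_def)
    then show ?thesis using blk_count count_a by simp
  qed
  define num where "num z = to_nat_on (D (\<beta> z)) z" for z
  have num_inj: "inj_on num (D m)" for m
    using inj_on_to_nat_on[OF \<open>countable (D m)\<close>] by (auto simp: inj_on_def num_def D_def)
  \<comment> \<open>The admissible positions for values of \<pi> inside block
    \<open>m\<close>.\<close>
  define A where "A m = num ` (D m \<inter> X)" for m
  have inf_A: "infinite (A (\<beta> z))" if "z \<in> ?Z" for z
  proof -
    have "{x \<in> X. a x = a z} \<subseteq> D (\<beta> z) \<inter> X"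
      by (auto simp: D_def \<beta>_def)
    then have "infinite (D (\<beta> z) \<inter> X)"
      using inf_a[OF that] finite_subset by blast
    moreover have "inj_on num (D (\<beta> z) \<inter> X)"
      using num_inj by (rule inj_on_subset) auto
    ultimately show ?thesis
      unfolding A_def by (simp add: finite_image_iff)
  qed
  \<comment> \<open>The element \<open>z\<close> is recovered from its block and its number. Numbers
    of support elements in other blocks also enter the maximum, which only raises the bound.\<close>
  define B where "B m n = (let z = inv_into (D m) num n in Max (num ` insert z (supp z)))" for m n
  have "\<exists>f. infinite (A m) \<longrightarrow> strict_mono f \<and> (\<forall>n. f n \<in> A m \<and> B m n < f n)" for m
    by (metis strict_mono_in_infinite_set_above)
  then obtain f where f: "\<And>m. infinite (A m) \<Longrightarrow> strict_mono (f m)"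
    "\<And>m n. infinite (A m) \<Longrightarrow> f m n \<in> A m" "\<And>m n. infinite (A m) \<Longrightarrow> B m n < f m n"
    by metis
  \<comment> \<open>The block of \<open>z\<close> is kept: support elements in smaller blocks then
    precede \<open>\<pi> z\<close> at once, and those in the same block do so by the choice of
    \<open>f\<close>.\<close>
  define \<pi> where "\<pi> z = inv_into (D (\<beta> z) \<inter> X) num (f (\<beta> z) (num z))" for z
  have \<pi>: "\<pi> z \<in> D (\<beta> z) \<inter> X" "num (\<pi> z) = f (\<beta> z) (num z)" if "z \<in> ?Z" for z
  proof -
    have "f (\<beta> z) (num z) \<in> num ` (D (\<beta> z) \<inter> X)"
      using f(2)[OF inf_A[OF that]] by (simp only: A_def)
    then show "\<pi> z \<in> D (\<beta> z) \<inter> X" "num (\<pi> z) = f (\<beta> z) (num z)"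
      unfolding \<pi>_def by (rule inv_into_into, rule f_inv_into_f)
  qed
  have \<beta>\<pi>: "\<beta> (\<pi> z) = \<beta> z" if "z \<in> ?Z" for z
    using \<pi>[OF that] by (auto simp: D_def)
  have less_\<pi>: "num w < num (\<pi> z)" if "z \<in> ?Z" "w \<in> insert z (supp z)" for z w
  proof -
    have "inv_into (D (\<beta> z)) num (num z) = z"
      using num_inj that by (auto simp: D_def intro!: inv_into_f_f)
    then have "num w \<le> B (\<beta> z) (num z)"
      using that supp by (auto simp: B_def intro!: Max_ge)
    also have "\<dots> < num (\<pi> z)"
      using \<pi> f(3) inf_A that by simp
    finally show ?thesis .
  qed
  define R where "R = inv_image (s <*lex*> less_than) (\<lambda>z. (\<beta> z, num z))"
  show ?thesis
  proof (rule that)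
    show "wf R" "trans R"
      using s by (auto simp: R_def intro!: trans_inv_image)
    show "total_on ?Z R"
      using s(3) num_inj by (fastforce simp: R_def total_on_def D_def inj_on_def)
    show "\<pi> ` ?Z \<subseteq> X"
      using \<pi> by auto
    show "insert z (supp z) \<subseteq> R\<inverse> `` {\<pi> z}" if "z \<in> ?Z" for z
      using \<beta>_supp[OF that] less_\<pi>[OF that] \<beta>\<pi>[OF that] by (auto simp: R_def dest: \<beta>_supp[OF that])
    show "(\<pi> z, \<pi> w) \<in> R" if "z \<in> ?Z" "w \<in> ?Z" "(z, w) \<in> R" for z w
      using that \<beta>\<pi> \<pi> f(1)[OF inf_A] by (auto simp: R_def strict_mono_less)
  qed
qed

subsection \<open>Triangular families\<close>

lemma finite_has_greatest:
  assumes "finite A" "A \<noteq> {}" "A \<subseteq> Z" "trans R" "total_on Z R"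
  shows "\<exists>m\<in>A. \<forall>z\<in>A. z = m \<or> (z, m) \<in> R"
  using assms(1,2,3)
proof (induction rule: finite_ne_induct)
  case (insert x F)
  then obtain m where m: "m \<in> F" "\<And>z. z \<in> F \<Longrightarrow> z = m \<or> (z, m) \<in> R" by auto
  consider "x = m" | "(x, m) \<in> R" | "(m, x) \<in> R"
    using insert.prems m(1) \<open>total_on Z R\<close> by (auto simp: total_on_def)
  then show ?case
  proof cases
    case 3
    then have "(z, x) \<in> R" if "z \<in> F" for z
      using m(2)[OF that] \<open>trans R\<close> by (auto dest: transD)
    then show ?thesis by auto
  qed (use m in auto)
qed auto

context vector_space
begin

text \<open>Leading terms: in a vanishing combination of the \<open>d z\<close>, the greatest index
  \<open>m\<close> with nonzero coefficient would put \<open>e m\<close> into the span of the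
  earlier \<open>e r\<close>. The spans agree by well-founded induction, as \<open>e z\<close> is
  \<open>d z\<close> up to earlier terms.\<close>

lemma unitriangular_family:
  fixes e d :: "'i \<Rightarrow> 'b"
  assumes "wf R" "trans R" "total_on Z R"
    and e: "inj_on e Z" "independent (e ` Z)"
    and d: "\<And>z. z \<in> Z \<Longrightarrow> d z - e z \<in> span (e ` {r \<in> Z. (r, z) \<in> R})"
  shows "inj_on d Z" "independent (d ` Z)" "span (d ` Z) = span (e ` Z)"
proof -
  define E where "E z = e ` {r \<in> Z. (r, z) \<in> R}" for z
  have E_mono: "span (E z) \<subseteq> span (E w)" if "(z, w) \<in> R" for z w
    using that \<open>trans R\<close> by (auto simp: E_def intro!: span_mono dest: transD)
  have scalars: "\<forall>z\<in>A. k z = 0"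
    if "finite A" "A \<subseteq> Z" "(\<Sum>z\<in>A. k z *s d z) = 0" for A k
  proof (rule ccontr)
    define A' where "A' = {z \<in> A. k z \<noteq> 0}"
    assume "\<not> ?thesis"
    then have "A' \<noteq> {}" "finite A'" "A' \<subseteq> Z"
      using that by (auto simp: A'_def)
    then obtain m where m: "m \<in> A'" "\<And>z. z \<in> A' \<Longrightarrow> z \<noteq> m \<Longrightarrow> (z, m) \<in> R"
      using finite_has_greatest assms(2,3) by metis
    have "(\<Sum>z\<in>A'. k z *s d z) = 0"
      using that by (subst sum.mono_neutral_cong_left[of A]) (auto simp: A'_def)
    then have "k m *s d m = - (\<Sum>z\<in>A' - {m}. k z *s d z)"
      using m \<open>finite A'\<close> by (simp add: sum.remove eq_neg_iff_add_eq_0)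
    moreover have "(\<Sum>z\<in>A' - {m}. k z *s d z) \<in> span (E m)"
    proof (intro span_sum span_scale)
      fix z assume "z \<in> A' - {m}"
      then have z: "z \<in> Z" "(z, m) \<in> R" using m \<open>A' \<subseteq> Z\<close> by auto
      then have "d z - e z \<in> span (E m)" "e z \<in> span (E m)"
        using d[of z] E_mono[of z m] by (auto simp: E_def intro: span_base)
      then show "d z \<in> span (E m)"
        using span_add by fastforce
    qed
    ultimately have "k m *s d m \<in> span (E m)"
      by (simp add: span_neg)
    then have "d m \<in> span (E m)"
      using m span_scale[of "k m *s d m" "E m" "inverse (k m)"] by (simp add: A'_def)
    moreover have "m \<in> Z" using m \<open>A' \<subseteq> Z\<close> by auto
    then have "d m - e m \<in> span (E m)"
      using d by (simp add: E_def)
    ultimately have "e m \<in> span (E m)"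
      using span_diff by fastforce
    moreover have "E m \<subseteq> e ` Z - {e m}"
      using \<open>m \<in> Z\<close> e(1) \<open>wf R\<close> by (auto simp: E_def inj_on_def)
    ultimately have "e m \<in> span (e ` Z - {e m})"
      using span_mono by blast
    then show False
      using e(2) \<open>m \<in> Z\<close> by (auto simp: dependent_def)
  qed
  show inj: "inj_on d Z"
  proof (rule inj_onI, rule ccontr)
    fix z w assume zw: "z \<in> Z" "w \<in> Z" "d z = d w" "z \<noteq> w"
    then show False
      using scalars[of "{z, w}" "\<lambda>x. if x = z then 1 else - 1"] by simp
  qed
  show "independent (d ` Z)"
    unfolding independent_explicit_finite_subsets
  proof (intro allI impI)
    fix S k assume S: "S \<subseteq> d ` Z" "finite S" "(\<Sum>v\<in>S. k v *s v) = 0"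
    then obtain A where A: "A \<subseteq> Z" "finite A" "S = d ` A"
      by (meson finite_subset_image)
    moreover have "inj_on d A"
      using inj A inj_on_subset by blast
    ultimately show "\<forall>v\<in>S. k v = 0"
      using S scalars[of A "k \<circ> d"] by (simp add: sum.reindex)
  qed
  have "d z \<in> span (e ` Z)" if "z \<in> Z" for z
  proof -
    have "d z - e z \<in> span (e ` Z)"
      using d[OF that] span_mono[of "e ` {r \<in> Z. (r, z) \<in> R}" "e ` Z"] by auto
    then show ?thesis
      using that span_add[of "d z - e z" _ "e z"] by (auto intro: span_base)
  qed
  moreover have "z \<in> Z \<longrightarrow> e z \<in> span (d ` Z)" for z
    using \<open>wf R\<close>
  proof (induction z rule: wf_induct_rule)
    case (less z)
    then have "span (e ` {r \<in> Z. (r, z) \<in> R}) \<subseteq> span (d ` Z)"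
      by (intro span_minimal) auto
    then show ?case
      using d[of z] span_diff[of "d z" "d ` Z" "d z - e z"] by (auto intro: span_base)
  qed
  ultimately show "span (d ` Z) = span (e ` Z)"
    by (intro antisym span_minimal) auto
qed

text \<open>Turns a family that \<open>M\<close> shifts up to lower terms into one that it shifts
  exactly: keep \<open>e z\<close> outside the image of \<pi> and apply \<open>M\<close> along the
  orbits. Monotonicity of \<pi> keeps the accumulated error below the current index.\<close>

lemma ex_orbit_family:
  fixes e :: "'i \<Rightarrow> 'b"
  assumes "wf R" "trans R"
    and M: "Vector_Spaces.linear scale scale M"
    and \<pi>: "\<pi> ` Z \<subseteq> Z" "inj_on \<pi> Z" "\<And>z. z \<in> Z \<Longrightarrow> (z, \<pi> z) \<in> R"
      "\<And>z w. z \<in> Z \<Longrightarrow> w \<in> Z \<Longrightarrow> (z, w) \<in> R \<Longrightarrow> (\<pi> z, \<pi> w) \<in> R"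
    and e: "\<And>z. z \<in> Z \<Longrightarrow> M (e z) - e (\<pi> z) \<in> span (e ` {r \<in> Z. (r, \<pi> z) \<in> R})"
  obtains d where "\<And>z. z \<in> Z \<Longrightarrow> d (\<pi> z) = M (d z)"
    "\<And>z. z \<in> Z \<Longrightarrow> d z - e z \<in> span (e ` {r \<in> Z. (r, z) \<in> R})"
proof -
  interpret M: Vector_Spaces.linear scale scale M by fact
  \<comment> \<open>The recursion for \<open>\<pi> w\<close> consults only \<open>w\<close>, which
    is \<open>R\<close>-smaller, so \<open>cut\<close> does not affect the value.\<close>
  define F where "F f z = (if z \<in> \<pi> ` Z then M (f (inv_into Z \<pi> z)) else e z)" for f :: "'i \<Rightarrow> 'b" and z
  define d where "d = wfrec R F"
  have d: "d z = F (cut d R z) z" for z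
    unfolding d_def by (rule wfrec[OF \<open>wf R\<close>])
  have d_\<pi>: "d (\<pi> z) = M (d z)" if "z \<in> Z" for z
    using that \<pi>(2,3) by (simp add: d[of "\<pi> z"] F_def cut_apply)
  define E where "E z = e ` {r \<in> Z. (r, z) \<in> R}" for z
  have E_mono: "span (E z) \<subseteq> span (E w)" if "(z, w) \<in> R" for z w
    using that \<open>trans R\<close> by (auto simp: E_def intro!: span_mono dest: transD)
  have M_E: "M ` span (E w) \<subseteq> span (E (\<pi> w))" if "w \<in> Z" for w
  proof -
    have "M (e r) \<in> span (E (\<pi> w))" if "r \<in> Z" "(r, w) \<in> R" for r
    proof -
      have *: "(\<pi> r, \<pi> w) \<in> R"
        using \<pi>(4) that \<open>w \<in> Z\<close> by simp
      have "M (e r) - e (\<pi> r) \<in> span (E (\<pi> w))"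
        using e[OF \<open>r \<in> Z\<close>] E_mono[OF *] by (auto simp: E_def)
      moreover have "e (\<pi> r) \<in> span (E (\<pi> w))"
        using * \<open>r \<in> Z\<close> \<pi>(1) by (auto simp: E_def intro!: span_base)
      ultimately show ?thesis
        using span_add by fastforce
    qed
    then have "M ` E w \<subseteq> span (E (\<pi> w))"
      by (auto simp: E_def)
    then show ?thesis
      by (simp add: span_minimal flip: M.span_image)
  qed
  have "z \<in> Z \<longrightarrow> d z - e z \<in> span (E z)" for z
    using \<open>wf R\<close>
  proof (induction z rule: wf_induct_rule)
    case (less z)
    show ?case
    proof (cases "z \<in> \<pi> ` Z")
      case True
      then obtain w where w: "w \<in> Z" "z = \<pi> w" by auto
      then have "d w - e w \<in> span (E w)"
        using less \<pi>(3) by auto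
      then have "M (d w - e w) \<in> span (E z)"
        using M_E w by auto
      moreover have "M (e w) - e z \<in> span (E z)"
        using e w by (simp add: E_def)
      ultimately have "M (d w - e w) + (M (e w) - e z) \<in> span (E z)"
        by (rule span_add)
      then show ?thesis
        using w d_\<pi> by (simp add: M.diff)
    next
      case False
      then show ?thesis by (simp add: d[of z] F_def span_zero)
    qed
  qed
  with that d_\<pi> show ?thesis
    by (auto simp: E_def)
qed

end

subsection \<open>Dimension and dominant eigenvalues\<close>

lemma lepoll_linear: "A \<lesssim> B \<or> B \<lesssim> A"
  unfolding lepoll_def card_of_ordLeq
  by (rule ordLeq_total) (rule card_of_Well_order)+

lemma infinite_Un_image_lepoll:
  assumes "infinite X"
  shows "X \<union> f ` X \<lesssim> X"
  using assms card_of_Un_ordLeq_infinite_Field[of "card_of X" X "f ` X"]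
  by (simp add: lepoll_def card_of_ordLeq card_of_image Field_card_of card_of_Card_order
      card_of_mono1 card_of_card_order_on)

context vector_space
begin

lemma finite_support_in_span:
  assumes "x \<in> span S"
  obtains F where "finite F" "F \<subseteq> S" "x \<in> span F"
  using assms unfolding span_explicit by blast

text \<open>Extend \<open>B\<close> to a basis \<open>C\<close> of \<open>span T\<close>. The finite
  supports in \<open>C\<close> of the elements of \<open>T\<close> must exhaust \<open>C\<close>,
  and a union of finite sets indexed by the infinite set \<open>T\<close> is no larger than
  \<open>T\<close>.\<close>

lemma independent_lepoll_spanning:
  assumes B: "independent B" "B \<subseteq> span T" and T: "infinite T"
  shows "B \<lesssim> T"
proof -
  obtain C where C: "B \<subseteq> C" "C \<subseteq> span T" "independent C" "span T \<subseteq> span C"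
    using maximal_independent_subset_extend[OF B(2,1)] by blast
  have "\<exists>F. finite F \<and> F \<subseteq> C \<and> t \<in> span F" if "t \<in> T" for t
    using that C(4) span_base finite_support_in_span by (metis subsetD)
  then obtain F where F: "\<And>t. t \<in> T \<Longrightarrow> finite (F t) \<and> F t \<subseteq> C \<and> t \<in> span (F t)"
    by metis
  have "T \<subseteq> span (\<Union>t\<in>T. F t)"
    using F span_mono by (metis UN_upper subsetD subsetI)
  then have C_sub: "C \<subseteq> span (\<Union>t\<in>T. F t)"
    using C(2) span_minimal by (metis subset_trans subspace_span)
  have "C \<subseteq> (\<Union>t\<in>T. F t)"
  proof (rule ccontr)
    assume "\<not> ?thesis"
    then obtain c where c: "c \<in> C" "c \<notin> (\<Union>t\<in>T. F t)" by blast
    then have "(\<Union>t\<in>T. F t) \<subseteq> C - {c}"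
      using F by blast
    then have "c \<in> span (C - {c})"
      using c C_sub span_mono by blast
    then show False
      using C(3) c(1) by (auto simp: dependent_def)
  qed
  moreover have "(card_of (F t), card_of T) \<in> ordLeq" if "t \<in> T" for t
    using F[OF that] T finite_lepoll_infinite[of T "F t"] by (simp add: lepoll_def card_of_ordLeq)
  then have "(card_of (\<Union>t\<in>T. F t), card_of T) \<in> ordLeq"
    using T by (intro card_of_UNION_ordLeq_infinite) (auto intro: card_of_mono1)
  ultimately have "(card_of (B), card_of T) \<in> ordLeq"
    using C(1) by (meson card_of_mono1 ordLeq_transitive order_trans)
  then show ?thesis
    by (simp add: lepoll_def card_of_ordLeq)
qed

text \<open>Here \<open>T\<close> merely spans a space containing the range. A basis of the range is
  finite if \<open>T\<close> is finite, and otherwise at most as large as \<open>T\<close>.\<close>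

lemma dominant_eigenvalue_if_small_range:
  assumes u: "Vector_Spaces.linear scale scale u"
    and C: "independent C" "span C = UNIV" "infinite C"
    and T: "T \<prec> C" "\<And>v. u v - lam *s v \<in> span T"
  shows "dominant_eigenvalue scale u lam"
proof -
  interpret u: Vector_Spaces.linear scale scale u by fact
  let ?R = "range (\<lambda>v. u v - lam *s v)"
  have "subspace ?R"
  proof (rule subspaceI)
    show "0 \<in> ?R" by (rule image_eqI[of _ _ 0]) auto
  next
    fix x y assume "x \<in> ?R" "y \<in> ?R"
    then obtain a b where "x = u a - lam *s a" "y = u b - lam *s b" by auto
    then show "x + y \<in> ?R"
      by (intro image_eqI[of _ _ "a + b"]) (auto simp: u.add scale_right_distrib)
  next
    fix c x assume "x \<in> ?R"
    then obtain a where "x = u a - lam *s a" by auto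
    then show "c *s x \<in> ?R"
      by (intro image_eqI[of _ _ "c *s a"]) (auto simp: u.scale scale_right_diff_distrib mult.commute)
  qed
  obtain B where B: "B \<subseteq> ?R" "independent B" "?R \<subseteq> span B"
    using maximal_independent_subset .
  then have "basis_of scale ?R B"
    using span_minimal[OF B(1) \<open>subspace ?R\<close>] by (auto simp: basis_of_def)
  moreover have "B \<subseteq> span T"
    using B T by auto
  then have "B \<prec> C"
    using independent_span_bound[of T B] independent_lepoll_spanning[of B T] B C T
    by (meson finite_lesspoll_infinite lesspoll_trans1)
  ultimately show ?thesis
    using C by (auto simp: dominant_eigenvalue_def dim_less_def basis_of_def)
qed

text \<open>Zorn's lemma gives a maximal \<open>X\<close> independent jointly with its image; let
  \<open>T\<close> be their union. By maximality, every vector outside \<open>span T\<close> is an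
  eigenvector modulo \<open>span T\<close>. If \<open>T\<close> were smaller than a basis, these
  eigenvalues would agree and their common value would be dominant.\<close>

lemma ex_large_independent_pairs:
  assumes u: "Vector_Spaces.linear scale scale u"
    and inf: "infinite_dimensional scale"
    and dom: "\<And>lam. \<not> dominant_eigenvalue scale u lam"
  obtains X where "infinite X" "inj_on u X" "X \<inter> u ` X = {}" "independent (X \<union> u ` X)"
    "\<And>B. independent B \<Longrightarrow> B \<lesssim> X"
proof -
  interpret u: Vector_Spaces.linear scale scale u by fact
  define \<A> where "\<A> = {X. inj_on u X \<and> X \<inter> u ` X = {} \<and> independent (X \<union> u ` X)}"
  have "\<exists>X\<in>\<A>. \<forall>Y\<in>\<A>. X \<subseteq> Y \<longrightarrow> Y = X"
  proof (rule subset_Zorn')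
    fix \<C> assume \<C>: "subset.chain \<A> \<C>"
    then have chain: "\<And>X Y. X \<in> \<C> \<Longrightarrow> Y \<in> \<C> \<Longrightarrow> X \<subseteq> Y \<or> Y \<subseteq> X" and sub: "\<C> \<subseteq> \<A>"
      by (auto simp: subset_chain_def)
    have common: "\<exists>X\<in>\<C>. x \<in> X \<and> y \<in> X" if "x \<in> \<Union>\<C>" "y \<in> \<Union>\<C>" for x y
      using that chain by blast
    have "inj_on u (\<Union>\<C>)"
    proof (rule inj_onI)
      fix x y assume "x \<in> \<Union>\<C>" "y \<in> \<Union>\<C>" "u x = u y"
      with common[of x y] sub show "x = y"
        by (auto simp: \<A>_def dest: inj_onD)
    qed
    moreover have "x \<noteq> u y" if "x \<in> \<Union>\<C>" "y \<in> \<Union>\<C>" for x y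
      using common[OF that] sub by (auto simp: \<A>_def)
    then have "\<Union>\<C> \<inter> u ` \<Union>\<C> = {}"
      by blast
    moreover have "independent (\<Union>((\<lambda>X. X \<union> u ` X) ` \<C>))"
    proof (rule independent_Union_directed)
      show "c \<subseteq> d \<or> d \<subseteq> c" if "c \<in> (\<lambda>X. X \<union> u ` X) ` \<C>" "d \<in> (\<lambda>X. X \<union> u ` X) ` \<C>" for c d
      proof -
        from that obtain X Y where "X \<in> \<C>" "Y \<in> \<C>" "c = X \<union> u ` X" "d = Y \<union> u ` Y" by auto
        then show ?thesis
          using chain[of X Y] by auto
      qed
      show "independent c" if "c \<in> (\<lambda>X. X \<union> u ` X) ` \<C>" for c
        using that sub by (auto simp: \<A>_def)
    qed
    moreover have "\<Union>((\<lambda>X. X \<union> u ` X) ` \<C>) = \<Union>\<C> \<union> u ` \<Union>\<C>"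
      by auto
    ultimately show "\<Union>\<C> \<in> \<A>"
      by (simp add: \<A>_def)
  qed
  then obtain X where X: "inj_on u X" "X \<inter> u ` X = {}" "independent (X \<union> u ` X)"
    and max: "\<And>Y. Y \<in> \<A> \<Longrightarrow> X \<subseteq> Y \<Longrightarrow> Y = X"
    by (auto simp: \<A>_def)
  define T where "T = X \<union> u ` X"
  \<comment> \<open>Otherwise \<open>y\<close> could be added to \<open>X\<close>.\<close>
  have u_in: "u y \<in> span (insert y T)" if "y \<notin> span T" for y
  proof (rule ccontr)
    assume *: "u y \<notin> span (insert y T)"
    then have "u y \<notin> insert y T" using span_base by blast
    have "y \<notin> T" using that span_base by blast
    have "independent (insert (u y) (insert y T))"
      using * that X(3) by (simp add: independent_insertI T_def)
    moreover have "insert (u y) (insert y T) = insert y X \<union> u ` insert y X"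
      by (auto simp: T_def)
    moreover have "insert y X \<inter> u ` insert y X = {}" "inj_on u (insert y X)"
      using X \<open>u y \<notin> insert y T\<close> \<open>y \<notin> T\<close> by (auto simp: T_def)
    ultimately have "insert y X = X"
      using max[of "insert y X"] by (auto simp: \<A>_def)
    then show False
      using \<open>y \<notin> T\<close> by (auto simp: T_def)
  qed
  obtain C where C: "independent C" "span C = UNIV"
    by (metis maximal_independent_subset[of UNIV] top.extremum_uniqueI)
  have "infinite C"
    using inf C by (auto simp: infinite_dimensional_def)
  have not_spanning: "span S \<noteq> UNIV" if "S \<prec> C" for S
  proof
    assume "span S = UNIV"
    then have "infinite S"
      using inf by (auto simp: infinite_dimensional_def)
    then have "C \<lesssim> S"
      using C \<open>span S = UNIV\<close> independent_lepoll_spanning by simp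
    then show False
      using that lesspoll_trans1 lesspoll_not_refl by blast
  qed
  have "\<not> T \<prec> C"
  proof
    assume T: "T \<prec> C"
    then obtain y where y: "y \<notin> span T"
      using not_spanning by blast
    then obtain lam where lam: "u y - lam *s y \<in> span T"
      using u_in span_breakdown_eq by blast
    define T' where "T' = insert y T"
    have "T' \<prec> C"
      using T \<open>infinite C\<close> unfolding T'_def
      by (metis finite_insert finite_lesspoll_infinite infinite_insert_eqpoll eq_lesspoll_trans)
    have sub: "span T \<subseteq> span T'"
      unfolding T'_def by (rule span_mono) auto
    \<comment> \<open>Modulo \<open>span T\<close>, the vectors \<open>y\<close> and
      \<open>z\<close> are independent, so comparing the eigenvalues of \<open>y\<close>,
      \<open>z\<close> and \<open>z + y\<close> forces all three to be equal.\<close>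
    have outside: "u z - lam *s z \<in> span T" if z: "z \<notin> span T'" for z
    proof -
      have "z + y \<notin> span T"
        using z sub span_diff[of "z + y" T' y] by (auto simp: T'_def span_base)
      then obtain k where k: "u (z + y) - k *s (z + y) \<in> span T"
        using u_in span_breakdown_eq by blast
      have "z \<notin> span T" using z sub by blast
      then obtain l where l: "u z - l *s z \<in> span T"
        using u_in span_breakdown_eq by blast
      have *: "(l - k) *s z + (lam - k) *s y \<in> span T"
        using span_diff[OF span_diff[OF k l] lam] by (simp add: u.add algebra_simps)
      have "l = k"
      proof (rule ccontr)
        assume "l \<noteq> k"
        have "(l - k) *s z + (lam - k) *s y - (lam - k) *s y \<in> span T'"
          using * sub by (intro span_diff span_scale) (auto simp: T'_def span_base)
        then have "(l - k) *s z \<in> span T'" by simp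
        then show False
          using z \<open>l \<noteq> k\<close> span_scale[of "(l - k) *s z" T' "inverse (l - k)"] by simp
      qed
      then have "(lam - k) *s y \<in> span T" using * by simp
      then have "lam = k"
        using y span_scale[of "(lam - k) *s y" T "inverse (lam - k)"] by (cases "lam = k") auto
      then show ?thesis using l \<open>l = k\<close> by simp
    qed
    obtain z where z: "z \<notin> span T'"
      using not_spanning[OF \<open>T' \<prec> C\<close>] by blast
    \<comment> \<open>A vector \<open>v\<close> in \<open>span T'\<close> is the difference of
      \<open>z + v\<close> and \<open>z\<close>, which both lie outside.\<close>
    have "u v - lam *s v \<in> span T" for v
    proof (cases "v \<in> span T'")
      case True
      then have "z + v \<notin> span T'"
        using z by (simp add: span_add_eq2)
      then have "(u (z + v) - lam *s (z + v)) - (u z - lam *s z) \<in> span T"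
        by (intro span_diff outside z)
      then show ?thesis
        by (simp add: u.add algebra_simps)
    qed (rule outside)
    then have "dominant_eigenvalue scale u lam"
      using dominant_eigenvalue_if_small_range u C \<open>infinite C\<close> T by blast
    then show False
      using dom by blast
  qed
  then have "C \<lesssim> T"
    using lepoll_linear[of C T] by (auto simp: lesspoll_def dest: eqpoll_sym intro: eqpoll_imp_lepoll)
  then have "infinite T"
    using \<open>infinite C\<close> by (metis finite_lepoll_infinite finite_lesspoll_infinite lesspoll_trans2 lesspoll_not_refl lesspoll_trans1)
  then have "infinite X"
    by (auto simp: T_def)
  have "B \<lesssim> X" if "independent B" for B
  proof -
    have "B \<lesssim> C"
      using that C \<open>infinite C\<close> independent_lepoll_spanning by simp
    also note \<open>C \<lesssim> T\<close>
    also have "T \<lesssim> X"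
      using infinite_Un_image_lepoll[OF \<open>infinite X\<close>] by (simp add: T_def)
    finally show ?thesis .
  qed
  with that X \<open>infinite X\<close> show ?thesis by blast
qed

end

subsection \<open>Blocks with opposite diagonals\<close>

context vector_space
begin

lemma ex_linear_on_independent_family:
  assumes "inj_on b Z" "independent (b ` Z)"
  obtains f where "Vector_Spaces.linear scale scale f" "\<And>z. z \<in> Z \<Longrightarrow> f (b z) = c z"
proof -
  interpret vector_space_pair scale scale ..
  show ?thesis
    using linear_independent_extend[OF assms(2), of "c \<circ> inv_into Z b"] assms(1) that
    by force
qed

lemma linear_eq_on_spanning:
  assumes "Vector_Spaces.linear scale scale f" "Vector_Spaces.linear scale scale g"
    and "span B = UNIV" "\<And>x. x \<in> B \<Longrightarrow> f x = g x"
  shows "f v = g v"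
proof -
  interpret vector_space_pair scale scale ..
  show ?thesis
    using linear_eq_on[OF assms(1,2), of v B] assms(3,4) by auto
qed

lemma linear_endoI:
  assumes "\<And>x y. f (x + y) = f x + f y" "\<And>c x. f (c *s x) = c *s f x"
  shows "Vector_Spaces.linear scale scale f"
  using assms vector_space_axioms by (simp add: Vector_Spaces.linear_iff)

text \<open>The map \<open>q\<close> is the projection onto \<open>V\<^sub>2\<close>, spanned by the
  \<open>d z\<close>, along \<open>V\<^sub>1\<close>, spanned by the \<open>b z\<close>. The last
  two assumptions state the diagonal blocks of \<open>u\<close>; the off-diagonal ones are
  arbitrary.\<close>

lemma ex_three_quadratic_summands:
  fixes u q :: "'b \<Rightarrow> 'b" and b d :: "'i \<Rightarrow> 'b"
  assumes u: "Vector_Spaces.linear scale scale u" and q: "Vector_Spaces.linear scale scale q"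
    and b: "inj_on b Z" "independent (b ` Z)" and d: "inj_on d Z" "independent (d ` Z)"
    and span: "span (b ` Z \<union> d ` Z) = UNIV"
    and q_b: "\<And>z. z \<in> Z \<Longrightarrow> q (b z) = 0" and q_d: "\<And>z. z \<in> Z \<Longrightarrow> q (d z) = d z"
    and \<pi>: "\<And>z. z \<in> Z \<Longrightarrow> \<pi> z \<in> Z"
    and u_b: "\<And>z. z \<in> Z \<Longrightarrow> u (b z) - q (u (b z)) = (l1 + m1 + l2 + m2 + l3 + m3) *s b z - b (\<pi> z)"
    and u_d: "\<And>z. z \<in> Z \<Longrightarrow> q (u (d z)) = d (\<pi> z)"
  obtains w1 w2 w3
  where "Vector_Spaces.linear scale scale w1" "\<And>v. w1 (w1 v) = (l1 + m1) *s w1 v - (l1 * m1) *s v"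
    "Vector_Spaces.linear scale scale w2" "\<And>v. w2 (w2 v) = (l2 + m2) *s w2 v - (l2 * m2) *s v"
    "Vector_Spaces.linear scale scale w3" "\<And>v. w3 (w3 v) = (l3 + m3) *s w3 v - (l3 * m3) *s v"
    "\<And>v. u v = w1 v + w2 v + w3 v"
proof -
  interpret u: Vector_Spaces.linear scale scale u by fact
  interpret q: Vector_Spaces.linear scale scale q by fact
  obtain \<beta> where \<beta>: "Vector_Spaces.linear scale scale \<beta>" and \<beta>_d: "\<And>z. z \<in> Z \<Longrightarrow> \<beta> (d z) = b z"
    using ex_linear_on_independent_family[OF d] by metis
  obtain \<gamma> where \<gamma>: "Vector_Spaces.linear scale scale \<gamma>" and \<gamma>_b: "\<And>z. z \<in> Z \<Longrightarrow> \<gamma> (b z) = d z"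
    using ex_linear_on_independent_family[OF b] by metis
  interpret \<beta>: Vector_Spaces.linear scale scale \<beta> by fact
  interpret \<gamma>: Vector_Spaces.linear scale scale \<gamma> by fact
  note hom = u.add u.scale u.diff q.add q.scale q.diff \<beta>.add \<beta>.scale \<beta>.diff \<gamma>.add \<gamma>.scale \<gamma>.diff
  note alg = scale_left_distrib scale_right_distrib scale_left_diff_distrib scale_right_diff_distrib

  \<comment> \<open>On each plane spanned by d z and c z, w3 acts as the companion matrix of its quadratic.\<close>
  define K where "K v = \<beta> v + q (u v) - (m1 + m2) *s v" for v
  define w3 where "w3 v = K (q v) + (let x = \<gamma> (v - q v)
    in (l3 + m3 + m1 + m2) *s K x - (l3 * m3) *s x - K (q (u x)))" for v
  \<comment> \<open>The \<open>d\<close> part makes the \<open>V\<^sub>2\<close> block of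
    \<open>u - w3\<close> equal to \<open>m1 + m2\<close>. As \<open>b z\<close> has coefficient 1,
    the \<open>c z\<close> and \<open>d z\<close> together span the space, so the quadratic for
    \<open>w3\<close> can be tested on them.\<close>
  define c where "c z = b z + d (\<pi> z) - (m1 + m2) *s d z" for z
  have "Vector_Spaces.linear scale scale K"
    by (rule linear_endoI) (simp_all add: K_def hom algebra_simps)
  then interpret K: Vector_Spaces.linear scale scale K .
  have w3: "Vector_Spaces.linear scale scale w3"
    by (rule linear_endoI) (simp_all add: w3_def Let_def hom K.add K.scale K.diff algebra_simps)
  interpret w3: Vector_Spaces.linear scale scale w3 by fact
  have K_d: "K (d z) = c z" if "z \<in> Z" for z
    using that by (simp add: K_def c_def \<beta>_d u_d)

  have w3_d: "w3 (d z) = c z" if "z \<in> Z" for z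
    using that by (simp add: w3_def q_d K_d)
  \<comment> \<open>This value is forced: solve the definition of \<open>c z\<close> for
    \<open>b z\<close> and apply \<open>w3\<close>, with \<open>w3 (c z)\<close> as the quadratic
    prescribes.\<close>
  have w3_b: "w3 (b z) = (l3 + m3 + m1 + m2) *s c z - (l3 * m3) *s d z - c (\<pi> z)" if "z \<in> Z" for z
    using that \<pi> by (simp add: w3_def q_b \<gamma>_b K_d u_d)
  have w3_c: "w3 (c z) = (l3 + m3) *s c z - (l3 * m3) *s d z" if "z \<in> Z" for z
  proof -
    have "w3 (c z) = w3 (b z) + w3 (d (\<pi> z)) - (m1 + m2) *s w3 (d z)"
      by (simp add: c_def w3.add w3.diff w3.scale)
    also have "\<dots> = (l3 + m3) *s c z - (l3 * m3) *s d z"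
      using that \<pi> by (simp add: w3_b w3_d alg)
    finally show ?thesis .
  qed
  define E where "E v = w3 (w3 v) - (l3 + m3) *s w3 v + (l3 * m3) *s v" for v
  have E_hom: "E (x + y) = E x + E y" "E (k *s x) = k *s E x" for x y k
    by (simp_all add: E_def w3.add w3.scale algebra_simps)
  have E: "Vector_Spaces.linear scale scale E"
    by (rule linear_endoI) (rule E_hom)+
  interpret E: Vector_Spaces.linear scale scale E by fact
  have E_d: "E (d z) = 0" if "z \<in> Z" for z
    using that by (simp add: E_def w3_d w3_c)
  have E_c: "E (c z) = 0" if "z \<in> Z" for z
    using that by (simp add: E_def w3_c w3_d w3.diff w3.scale)
  have E_b: "E (b z) = 0" if "z \<in> Z" for z
  proof -
    have "b z = c z - d (\<pi> z) + (m1 + m2) *s d z"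
      by (simp add: c_def)
    then show ?thesis
      using that \<pi> by (simp only: E.add E.diff E.scale) (simp add: E_c E_d)
  qed
  have zero: "Vector_Spaces.linear scale scale (\<lambda>v. 0)"
    by (rule linear_endoI) auto
  have E_0: "E v = 0" for v
    by (rule linear_eq_on_spanning[OF E zero span]) (use E_b E_d in auto)

  define v where "v x = u x - w3 x" for x
  define p where "p x = x - q x" for x
  have qq: "q (q x) = q x" for x
  proof (rule linear_eq_on_spanning[OF _ q span])
    show "Vector_Spaces.linear scale scale (\<lambda>x. q (q x))"
      by (rule linear_endoI) (simp_all add: hom)
  qed (use q_b q_d in auto)
  have p_hom: "p (x + y) = p x + p y" "p (k *s x) = k *s p x" for x y k
    by (simp_all add: p_def hom alg)
  have v_hom: "v (x + y) = v x + v y" "v (k *s x) = k *s v x" for x y k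
    by (simp_all add: v_def hom w3.add w3.scale alg)
  have pp: "p (p x) = p x" "p (q x) = 0" "q (p x) = 0" for x
    by (simp_all add: p_def hom qq)
  have qvq: "q (v (q x)) = (m1 + m2) *s q x" for x
  proof (rule linear_eq_on_spanning[where f = "\<lambda>x. q (v (q x))" and g = "\<lambda>x. (m1 + m2) *s q x", OF _ _ span])
    show "Vector_Spaces.linear scale scale (\<lambda>x. q (v (q x)))"
      "Vector_Spaces.linear scale scale (\<lambda>x. (m1 + m2) *s q x)"
      by (rule linear_endoI; simp add: hom v_hom algebra_simps)+
    fix x assume "x \<in> b ` Z \<union> d ` Z"
    then show "q (v (q x)) = (m1 + m2) *s q x"
      using \<pi> by (auto simp: q_b q_d v_def w3_d u_d c_def hom)
  qed
  \<comment> \<open>The shift terms of \<open>u\<close> and \<open>w3\<close> cancel, and of the sum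
    of the six roots only \<open>l1 + l2\<close> remains.\<close>
  have pvp: "p (v (p x)) = (l1 + l2) *s p x" for x
  proof (rule linear_eq_on_spanning[where f = "\<lambda>x. p (v (p x))" and g = "\<lambda>x. (l1 + l2) *s p x", OF _ _ span])
    show "Vector_Spaces.linear scale scale (\<lambda>x. p (v (p x)))"
      "Vector_Spaces.linear scale scale (\<lambda>x. (l1 + l2) *s p x)"
      by (rule linear_endoI; simp add: p_hom v_hom algebra_simps)+
    have "p (v (p (b z))) = (l1 + l2) *s p (b z)" if "z \<in> Z" for z
    proof -
      have "p (w3 (b z)) = (l3 + m3 + m1 + m2) *s b z - b (\<pi> z)"
        using that \<pi> by (simp add: w3_b c_def p_def hom q_b q_d alg)
      moreover have "p (u (b z)) = (l1 + m1 + l2 + m2 + l3 + m3) *s b z - b (\<pi> z)"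
        using that by (simp add: p_def u_b)
      moreover have "p (v (b z)) = p (u (b z)) - p (w3 (b z))"
        by (simp add: p_def v_def hom)
      ultimately show ?thesis
        using that by (simp add: p_def q_b alg)
    qed
    moreover have "p (d z) = 0" if "z \<in> Z" for z
      using that by (simp add: p_def q_d)
    ultimately show "p (v (p x)) = (l1 + l2) *s p x" if "x \<in> b ` Z \<union> d ` Z" for x
      using that by (auto simp: v_def p_def)
  qed
  \<comment> \<open>A block triangular operator with scalar diagonal blocks \<open>l1\<close> and
    \<open>m1\<close> is annihilated by the quadratic with these roots, whatever its remaining
    block. Hence each off-diagonal block of \<open>v\<close> can go entirely to one of
    \<open>w1\<close> and \<open>w2\<close>.\<close>
  define w1 where "w1 x = l1 *s p x + m1 *s q x + p (v (q x))" for x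
  define w2 where "w2 x = l2 *s p x + m2 *s q x + q (v (p x))" for x
  have split: "p x + q x = x" for x
    by (simp add: p_def)
  have v0: "p 0 = 0" "v 0 = 0"
    by (simp_all add: p_def v_def)
  show ?thesis
  proof (rule that)
    show "Vector_Spaces.linear scale scale w1" "Vector_Spaces.linear scale scale w2"
      by (rule linear_endoI; simp add: w1_def w2_def p_hom v_hom hom algebra_simps)+
    show "Vector_Spaces.linear scale scale w3" by fact
    show "w3 (w3 x) = (l3 + m3) *s w3 x - (l3 * m3) *s x" for x
      using E_0[of x] by (simp add: E_def algebra_simps)
    show "w1 (w1 x) = (l1 + m1) *s w1 x - (l1 * m1) *s x" for x
    proof -
      have "p (w1 x) = l1 *s p x + p (v (q x))" "q (w1 x) = m1 *s q x"
        by (simp_all add: w1_def p_hom hom pp qq)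
      then have "w1 (w1 x) = l1 *s (l1 *s p x + p (v (q x))) + m1 *s m1 *s q x + m1 *s p (v (q x))"
        by (simp add: w1_def[of "w1 x"] v_hom p_hom)
      moreover have "(l1 * m1) *s x = (l1 * m1) *s p x + (l1 * m1) *s q x"
        by (simp add: split flip: scale_right_distrib)
      ultimately show ?thesis
        by (simp add: w1_def algebra_simps)
    qed
    show "w2 (w2 x) = (l2 + m2) *s w2 x - (l2 * m2) *s x" for x
    proof -
      have "q (w2 x) = m2 *s q x + q (v (p x))" "p (w2 x) = l2 *s p x"
        by (simp_all add: w2_def p_hom hom pp qq)
      then have "w2 (w2 x) = l2 *s l2 *s p x + m2 *s (m2 *s q x + q (v (p x))) + l2 *s q (v (p x))"
        by (simp add: w2_def[of "w2 x"] v_hom hom)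
      moreover have "(l2 * m2) *s x = (l2 * m2) *s p x + (l2 * m2) *s q x"
        by (simp add: split flip: scale_right_distrib)
      ultimately show ?thesis
        by (simp add: w2_def algebra_simps)
    qed
    show "u x = w1 x + w2 x + w3 x" for x
    proof -
      have "v x = v (p x) + v (q x)"
        by (simp add: split flip: v_hom)
      also have "\<dots> = (p (v (p x)) + q (v (p x))) + (p (v (q x)) + q (v (q x)))"
        by (simp only: split)
      also have "\<dots> = w1 x + w2 x"
        by (simp add: pvp qvq w1_def w2_def alg)
      finally show ?thesis
        by (simp add: v_def algebra_simps)
    qed
  qed
qed

end

subsection \<open>The decomposition\<close>

context vector_space
begin

lemma independent_if_independent_image:
  assumes f: "Vector_Spaces.linear scale scale f" and S: "inj_on f S" "independent (f ` S)"
  shows "independent S"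
proof
  interpret f: Vector_Spaces.linear scale scale f by fact
  assume "dependent S"
  then obtain a where a: "a \<in> S" "a \<in> span (S - {a})"
    by (auto simp: dependent_def)
  then have "f a \<in> span (f ` (S - {a}))"
    by (auto simp: f.span_image)
  moreover have "f ` (S - {a}) = f ` S - {f a}"
    using S(1) a(1) by (auto simp: inj_on_def)
  ultimately show False
    using S(2) a(1) by (auto simp: dependent_def)
qed

lemma sum_of_three_quadratics:
  fixes l1 m1 l2 m2 l3 m3 :: 'a
  assumes u: "Vector_Spaces.linear scale scale u"
    and inf: "infinite_dimensional scale"
    and dom: "\<And>lam. \<not> dominant_eigenvalue scale u lam"
  obtains w1 w2 w3
  where "Vector_Spaces.linear scale scale w1" "\<And>v. w1 (w1 v) = (l1 + m1) *s w1 v - (l1 * m1) *s v"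
    "Vector_Spaces.linear scale scale w2" "\<And>v. w2 (w2 v) = (l2 + m2) *s w2 v - (l2 * m2) *s v"
    "Vector_Spaces.linear scale scale w3" "\<And>v. w3 (w3 v) = (l3 + m3) *s w3 v - (l3 * m3) *s v"
    "\<And>v. u v = w1 v + w2 v + w3 v"
proof -
  interpret u: Vector_Spaces.linear scale scale u by fact
  interpret vector_space_pair scale scale ..
  define \<sigma> where "\<sigma> = l1 + m1 + l2 + m2 + l3 + m3"
  obtain X where X: "infinite X" "inj_on u X" "X \<inter> u ` X = {}" "independent (X \<union> u ` X)"
    and large: "\<And>B :: 'b set. independent B \<Longrightarrow> B \<lesssim> X"
    by (rule ex_large_independent_pairs[OF u inf dom]) (rule that; assumption)
  obtain C where C: "X \<union> u ` X \<subseteq> C" "independent C" "UNIV \<subseteq> span C"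
    by (rule maximal_independent_subset_extend[OF subset_UNIV X(4)]) (rule that; assumption)
  define G where "G = C - (X \<union> u ` X)"
  define Z where "Z = X \<union> G"
  \<comment> \<open>Indexes the basis vectors outside \<open>X\<close>, so that the single set
    \<open>Z\<close> can index bases of both summands.\<close>
  define \<iota> where "\<iota> z = (if z \<in> X then u z else z)" for z
  have "G \<lesssim> X"
    by (rule large, rule independent_mono[OF C(2)]) (auto simp: G_def)
  have C_eq: "C = X \<union> \<iota> ` Z" and disj: "X \<inter> \<iota> ` Z = {}" "X \<inter> G = {}"
    using C(1) X(3) by (auto simp: Z_def \<iota>_def G_def)
  have inj_\<iota>: "inj_on \<iota> Z"
    using X(2) by (auto simp: inj_on_def \<iota>_def Z_def G_def)
  have "\<exists>F. finite F \<and> F \<subseteq> C \<and> u (\<iota> z) \<in> span F" for z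
    using C(3) finite_support_in_span by (metis UNIV_I subsetD)
  then obtain F where F: "\<And>z. finite (F z)" "\<And>z. F z \<subseteq> C" "\<And>z. u (\<iota> z) \<in> span (F z)"
    by metis
  \<comment> \<open>Only basis vectors outside \<open>X\<close> are recorded, because
    \<open>q\<close> will vanish on \<open>X\<close>.\<close>
  define supp where "supp z = \<iota> -` F z \<inter> Z" for z
  have supp: "finite (supp z) \<and> supp z \<subseteq> X \<union> G" for z
    using finite_vimage_IntI[OF F(1) inj_\<iota>] by (auto simp: supp_def Z_def)
  obtain R \<pi> where R: "wf R" "trans R" "total_on Z R"
    and \<pi>X: "\<pi> ` Z \<subseteq> X"
    and \<pi>R: "\<And>z. z \<in> Z \<Longrightarrow> insert z (supp z) \<subseteq> R\<inverse> `` {\<pi> z}"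
    and \<pi>_mono: "\<And>z w. z \<in> Z \<Longrightarrow> w \<in> Z \<Longrightarrow> (z, w) \<in> R \<Longrightarrow> (\<pi> z, \<pi> w) \<in> R"
    by (rule ex_dominating_successor[where supp = supp, OF X(1) \<open>G \<lesssim> X\<close> supp, folded Z_def]) (rule that, assumption+)
  have \<pi>Z: "\<pi> z \<in> X" "\<pi> z \<in> Z" if "z \<in> Z" for z
    using \<pi>X that by (auto simp: Z_def)
  have less_\<pi>: "(z, \<pi> z) \<in> R" if "z \<in> Z" for z
    using \<pi>R[OF that] by auto
  have inj_\<pi>: "inj_on \<pi> Z"
  proof (rule inj_onI, rule ccontr)
    fix z w assume zw: "z \<in> Z" "w \<in> Z" "\<pi> z = \<pi> w" "z \<noteq> w"
    then have "(z, w) \<in> R \<or> (w, z) \<in> R"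
      using R(3) by (simp add: total_on_def)
    then have "(\<pi> z, \<pi> z) \<in> R"
      using \<pi>_mono[of z w] \<pi>_mono[of w z] zw by auto
    then show False using R(1) by auto
  qed

  define d0 where "d0 z = \<iota> z + \<pi> z" for z
  \<comment> \<open>The projection onto the span of the \<open>d0 z\<close> along
    \<open>span X\<close>: the value at \<open>\<iota> z = d0 z - \<pi> z\<close> has to be
    \<open>d0 z\<close>.\<close>
  obtain q where q: "Vector_Spaces.linear scale scale q"
    and "\<forall>c\<in>C. q c = (if c \<in> X then 0 else d0 (inv_into Z \<iota> c))"
    using linear_independent_extend[OF C(2), of "\<lambda>c. if c \<in> X then 0 else d0 (inv_into Z \<iota> c)"] by blast
  then have q_X: "q x = 0" if "x \<in> X" for x
    using that C_eq by auto
  have q_\<iota>: "q (\<iota> z) = d0 z" if "z \<in> Z" for z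
  proof -
    have "\<iota> z \<notin> X" "\<iota> z \<in> C" using that disj C_eq by auto
    then show ?thesis
      using that inj_\<iota> \<open>\<forall>c\<in>C. _\<close> by simp
  qed
  interpret q: Vector_Spaces.linear scale scale q by fact
  have q_d0: "q (d0 z) = d0 z" if "z \<in> Z" for z
    using that \<pi>Z q_\<iota> q_X by (simp add: d0_def[of z] q.add)
  \<comment> \<open>Killing \<open>X\<close> sends \<open>d0 z\<close> back to
    \<open>\<iota> z\<close>, which yields independence of the \<open>d0 z\<close>.\<close>
  obtain f where f: "Vector_Spaces.linear scale scale f"
    and f_C: "\<forall>c\<in>C. f c = (if c \<in> X then 0 else c)"
    using linear_independent_extend[OF C(2), of "\<lambda>c. if c \<in> X then 0 else c"] by blast
  have f_d0: "f (d0 z) = \<iota> z" if "z \<in> Z" for z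
  proof -
    interpret f: Vector_Spaces.linear scale scale f by fact
    have "\<iota> z \<notin> X" "\<iota> z \<in> C" "\<pi> z \<in> X" "\<pi> z \<in> C"
      using that disj C_eq \<pi>Z by auto
    then show ?thesis
      using f_C by (simp add: d0_def f.add)
  qed
  have d0: "inj_on d0 Z" "independent (d0 ` Z)"
  proof -
    show "inj_on d0 Z"
      using f_d0 inj_\<iota> by (metis inj_on_def)
    have "inj_on f (d0 ` Z)"
      using f_d0 inj_\<iota> by (auto simp: inj_on_def)
    moreover have "f ` d0 ` Z = \<iota> ` Z"
      using f_d0 by (force simp: image_iff)
    then have "independent (f ` d0 ` Z)"
      using C(2) C_eq independent_mono by (metis Un_upper2)
    ultimately show "independent (d0 ` Z)"
      by (rule independent_if_independent_image[OF f])
  qed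

  have \<pi>ZZ: "\<pi> ` Z \<subseteq> Z" and \<pi>XX: "\<pi> ` X \<subseteq> X" and inj_\<pi>X: "inj_on \<pi> X"
    using \<pi>Z inj_\<pi> by (auto simp: Z_def inj_on_Un)
  have qu: "Vector_Spaces.linear scale scale (\<lambda>v. q (u v))"
    by (rule linear_endoI) (simp_all add: u.add u.scale q.add q.scale)
  \<comment> \<open>The summand \<open>\<pi> z\<close> of \<open>d0 z\<close> lies in
    \<open>X\<close>, so \<open>u\<close> maps it to \<open>\<iota> (\<pi> z)\<close> and
    \<open>q\<close> maps that to \<open>d0 (\<pi> z)\<close>. The other summand contributes only
    indices in \<open>supp z\<close>, all below \<open>\<pi> z\<close>.\<close>
  have qu_d0: "q (u (d0 z)) - d0 (\<pi> z) \<in> span (d0 ` {r \<in> Z. (r, \<pi> z) \<in> R})" if z: "z \<in> Z" for z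
  proof -
    have "u (\<pi> z) = \<iota> (\<pi> z)"
      using \<pi>Z z by (simp add: \<iota>_def)
    then have "q (u (d0 z)) - d0 (\<pi> z) = q (u (\<iota> z))"
      using q_\<iota> \<pi>Z z by (simp add: d0_def[of z] u.add q.add)
    also have "\<dots> \<in> span (q ` F z)"
      using F(3) by (auto simp: q.span_image)
    also have "span (q ` F z) \<subseteq> span (d0 ` {r \<in> Z. (r, \<pi> z) \<in> R})"
    proof (intro span_minimal subspace_span subsetI)
      fix y assume "y \<in> q ` F z"
      then obtain c where c: "c \<in> F z" "y = q c" by auto
      then consider "c \<in> X" | r where "r \<in> Z" "c = \<iota> r"
        using F(2) C_eq by blast
      then show "y \<in> span (d0 ` {r \<in> Z. (r, \<pi> z) \<in> R})"
      proof cases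
        case 1
        then show ?thesis using c q_X by (simp add: span_zero)
      next
        case 2
        then have "(r, \<pi> z) \<in> R"
          using \<pi>R[OF z] c by (auto simp: supp_def)
        then show ?thesis
          using 2 c q_\<iota> by (auto intro!: span_base)
      qed
    qed
    finally show ?thesis .
  qed
  obtain d where d_\<pi>: "\<And>z. z \<in> Z \<Longrightarrow> d (\<pi> z) = q (u (d z))"
    and d_low: "\<And>z. z \<in> Z \<Longrightarrow> d z - d0 z \<in> span (d0 ` {r \<in> Z. (r, z) \<in> R})"
    by (rule ex_orbit_family[OF R(1,2) qu \<pi>ZZ inj_\<pi> less_\<pi> \<pi>_mono qu_d0])
      (assumption | rule that, assumption+)+
  have d: "inj_on d Z" "independent (d ` Z)" "span (d ` Z) = span (d0 ` Z)"
    by (rule unitriangular_family[OF R d0 d_low], assumption)+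

  \<comment> \<open>On \<open>span X\<close> this is \<sigma> minus the diagonal block of
    \<open>u\<close>; it is to become the shift.\<close>
  define M where "M v = \<sigma> *s v - (u v - q (u v))" for v
  have M: "Vector_Spaces.linear scale scale M"
    by (rule linear_endoI) (simp_all add: M_def u.add u.scale q.add q.scale algebra_simps)
  have XZ: "x \<in> Z" if "x \<in> X" for x
    using that by (simp add: Z_def)
  \<comment> \<open>Since \<open>q (u x) = u x + \<pi> x\<close>, the value of \<open>M\<close> at
    \<open>x\<close> is \<open>\<sigma> *s x + \<pi> x\<close>, and \<open>x\<close> lies below
    \<open>\<pi> x\<close>.\<close>
  have M_X: "M (id x) - id (\<pi> x) \<in> span (id ` {r \<in> X. (r, \<pi> x) \<in> R})" if "x \<in> X" for x
  proof -
    have "u x = \<iota> x" using that by (auto simp: \<iota>_def)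
    then have "M (id x) - id (\<pi> x) = \<sigma> *s x"
      using q_\<iota> XZ[OF that] by (simp add: M_def d0_def)
    moreover have "\<sigma> *s x \<in> span (id ` {r \<in> X. (r, \<pi> x) \<in> R})"
      using that XZ less_\<pi> by (intro span_scale span_base) auto
    ultimately show ?thesis by simp
  qed
  obtain t where t_\<pi>: "\<And>x. x \<in> X \<Longrightarrow> t (\<pi> x) = M (t x)"
    and t_low: "\<And>x. x \<in> X \<Longrightarrow> t x - id x \<in> span (id ` {r \<in> X. (r, x) \<in> R})"
    by (rule ex_orbit_family[OF R(1,2) M \<pi>XX inj_\<pi>X less_\<pi>[OF XZ] \<pi>_mono[OF XZ XZ] M_X])
      (assumption | rule that, assumption+)+
  have X': "total_on X R" "independent (id ` X)"
    using R(3) independent_mono[OF X(4), of X] by (auto simp: Z_def total_on_def)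
  have t: "inj_on t X" "independent (t ` X)" "span (t ` X) = span (id ` X)"
    by (rule unitriangular_family[OF R(1,2) X'(1) inj_on_id X'(2) t_low], assumption)+

  \<comment> \<open>(Z, \<pi>) and (X, \<pi>) are isomorphic: push the orbits starting in G one step forward.\<close>
  define W where "W = (\<Union>n. (\<pi> ^^ n) ` G)"
  have W_Z: "z \<in> Z" if "z \<in> W" for z
  proof -
    have "(\<pi> ^^ n) g \<in> Z" if "g \<in> G" for n g
      using that \<pi>Z by (induction n) (auto simp: Z_def)
    then show ?thesis using that by (auto simp: W_def)
  qed
  have W_\<pi>: "\<pi> z \<in> W" if "z \<in> W" for z
  proof -
    from that obtain n g where "g \<in> G" "z = (\<pi> ^^ n) g" by (auto simp: W_def)
    then have "\<pi> z = (\<pi> ^^ Suc n) g" by simp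
    with \<open>g \<in> G\<close> show ?thesis
      unfolding W_def by blast
  qed
  have W_cases: "z \<in> G \<or> (\<exists>w\<in>W. z = \<pi> w)" if "z \<in> W" for z
  proof -
    from that obtain n g where g: "g \<in> G" "z = (\<pi> ^^ n) g" by (auto simp: W_def)
    then show ?thesis
      by (cases n) (auto simp: W_def)
  qed
  have W_\<pi>_iff: "\<pi> z \<in> W \<longleftrightarrow> z \<in> W" if "z \<in> Z" for z
  proof
    assume "\<pi> z \<in> W"
    moreover have "\<pi> z \<notin> G"
      using \<pi>Z that disj(2) by blast
    ultimately obtain w where w: "w \<in> W" "\<pi> z = \<pi> w"
      using W_cases by blast
    then have "z = w"
      using inj_onD[OF inj_\<pi> w(2) that W_Z] by simp
    with w show "z \<in> W" by simp
  qed (rule W_\<pi>)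
  have G_W: "G \<subseteq> W"
    unfolding W_def by (rule order_trans[OF _ UN_upper[of 0]]) auto
  define \<theta> where "\<theta> z = (if z \<in> W then \<pi> z else z)" for z
  have \<theta>_X: "\<theta> z \<in> X" if "z \<in> Z" for z
    using that \<pi>Z G_W by (auto simp: \<theta>_def Z_def)
  have \<theta>_inj: "inj_on \<theta> Z"
  proof (rule inj_onI)
    fix z w assume zw: "z \<in> Z" "w \<in> Z" "\<theta> z = \<theta> w"
    then have "z \<in> W \<longleftrightarrow> w \<in> W"
      using W_\<pi>_iff[of z] W_\<pi>_iff[of w] by (auto simp: \<theta>_def split: if_splits)
    then show "z = w"
      using zw inj_onD[OF inj_\<pi>, of z w] by (auto simp: \<theta>_def split: if_splits)
  qed
  \<comment> \<open>An element of \<open>X\<close> that lies in \<open>W\<close> is not in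
    \<open>G\<close>, so it has a predecessor in \<open>W\<close>.\<close>
  have "x \<in> \<theta> ` Z" if x: "x \<in> X" for x
  proof (cases "x \<in> W")
    case True
    then obtain w where "w \<in> W" "x = \<pi> w"
      using W_cases[OF True] x disj(2) by blast
    then show ?thesis
      using W_Z by (auto simp: \<theta>_def intro!: image_eqI[of _ _ w])
  next
    case False
    then show ?thesis
      using x by (auto simp: \<theta>_def Z_def intro!: image_eqI[of _ _ x])
  qed
  then have \<theta>_im: "\<theta> ` Z = X"
    using \<theta>_X by auto
  have \<theta>_\<pi>: "\<theta> (\<pi> z) = \<pi> (\<theta> z)" if "z \<in> Z" for z
    using that W_\<pi>_iff by (simp add: \<theta>_def)
  \<comment> \<open>Reindexes \<open>t\<close> from \<open>X\<close> to \<open>Z\<close>, to match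
    \<open>d\<close>. As \<theta> commutes with \<pi>, the shift relation carries over.\<close>
  define b where "b = t \<circ> \<theta>"
  have b_im: "b ` Z = t ` X"
    unfolding b_def image_comp[symmetric] \<theta>_im ..
  have span_b: "span (b ` Z) = span X" and span_d: "span (d ` Z) = span (d0 ` Z)"
    using b_im t(3) d(3) by simp_all

  show ?thesis
  proof (rule ex_three_quadratic_summands[OF u q, of b Z d \<pi> l1 m1 l2 m2 l3 m3])
    show "inj_on b Z"
      unfolding b_def using \<theta>_inj t(1) \<theta>_im by (simp add: comp_inj_on)
    show "independent (b ` Z)"
      using b_im t(2) by simp
    show "inj_on d Z" "independent (d ` Z)"
      by (rule d)+
    have "X \<subseteq> span (b ` Z \<union> d ` Z)"
      using span_b span_mono[of "b ` Z" "b ` Z \<union> d ` Z"] span_superset[of X] by auto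
    moreover have "d0 ` Z \<subseteq> span (b ` Z \<union> d ` Z)"
      using span_d span_mono[of "d ` Z" "b ` Z \<union> d ` Z"] span_superset[of "d0 ` Z"] by auto
    moreover have "\<iota> z = d0 z - \<pi> z" for z
      by (simp add: d0_def)
    ultimately have "C \<subseteq> span (b ` Z \<union> d ` Z)"
      using \<pi>Z unfolding C_eq by (auto simp: image_subset_iff intro!: span_diff)
    then show "span (b ` Z \<union> d ` Z) = UNIV"
      using C(3) span_minimal[OF _ subspace_span] by blast
    show "q (b z) = 0" if "z \<in> Z" for z
    proof (rule q.eq_0_on_span[OF q_X])
      show "b z \<in> span X"
        using that span_b span_base[of "b z" "b ` Z"] by simp
    qed
    show "q (d z) = d z" if "z \<in> Z" for z
    proof -
      have "d z \<in> span (d0 ` Z)"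
        using that span_d span_base[of "d z" "d ` Z"] by simp
      then show ?thesis
        using q_d0 linear_eq_on[OF q linear_id, of "d z" "d0 ` Z"] by auto
    qed
    show "\<pi> z \<in> Z" if "z \<in> Z" for z
      using \<pi>Z that by blast
    show "u (b z) - q (u (b z)) = (l1 + m1 + l2 + m2 + l3 + m3) *s b z - b (\<pi> z)" if "z \<in> Z" for z
      using t_\<pi>[OF \<theta>_X[OF that]] \<theta>_\<pi>[OF that] by (simp add: b_def M_def \<sigma>_def)
    show "q (u (d z)) = d (\<pi> z)" if "z \<in> Z" for z
      using d_\<pi> that by simp
  qed (rule that, assumption+)
qed

end

section \<open>From quadratic operator identities to split polynomials, by Vieta's formulas\<close>

lemma poly_endo_quadratic:
  fixes scale :: "'f::field \<Rightarrow> 'v::ab_group_add \<Rightarrow> 'v"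
  assumes "vector_space scale" "degree p = 2" "p = smult c ([:- a, 1:] * [:- b, 1:])"
    and "\<And>v. w (w v) = scale (a + b) (w v) - scale (a * b) v"
  shows "poly_endo scale p w v = 0"
proof -
  interpret vector_space scale by fact
  have coeffs: "coeff p 0 = c * (a * b)" "coeff p (Suc 0) = - (c * (a + b))" "coeff p (Suc (Suc 0)) = c"
    unfolding assms(3) by (simp_all add: algebra_simps)
  have "poly_endo scale p w v =
      scale (c * (a * b)) v + scale (- (c * (a + b))) (w v) + scale c (w (w v))"
    unfolding poly_endo_def assms(2) by (simp add: numeral_2_eq_2 atMost_Suc coeffs del: mult_minus_left)
  also have "\<dots> = 0"
    unfolding assms(4) by (simp add: algebra_simps)
  finally show ?thesis .
qed

theorem theorem2:
  fixes scale :: "'f::field \<Rightarrow> 'v::ab_group_add \<Rightarrow> 'v"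
    and u :: "'v \<Rightarrow> 'v"
    and p1 p2 p3 :: "'f poly"
  assumes "vector_space scale"
    and "infinite_dimensional scale"
    and "Vector_Spaces.linear scale scale u"
    and "\<forall>lam. \<not> dominant_eigenvalue scale u lam"
    and "split_deg2 p1" and "split_deg2 p2" and "split_deg2 p3"
  shows "is_poly_sum scale [p1, p2, p3] u"
proof -
  interpret vector_space scale by fact
  obtain a1 b1 where 1: "degree p1 = 2" "p1 = smult (lead_coeff p1) ([:- a1, 1:] * [:- b1, 1:])"
    using assms(5) unfolding split_deg2_def by blast
  obtain a2 b2 where 2: "degree p2 = 2" "p2 = smult (lead_coeff p2) ([:- a2, 1:] * [:- b2, 1:])"
    using assms(6) unfolding split_deg2_def by blast
  obtain a3 b3 where 3: "degree p3 = 2" "p3 = smult (lead_coeff p3) ([:- a3, 1:] * [:- b3, 1:])"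
    using assms(7) unfolding split_deg2_def by blast
  obtain w1 w2 w3 where
    w1: "Vector_Spaces.linear scale scale w1" "\<And>v. w1 (w1 v) = scale (a1 + b1) (w1 v) - scale (a1 * b1) v" and
    w2: "Vector_Spaces.linear scale scale w2" "\<And>v. w2 (w2 v) = scale (a2 + b2) (w2 v) - scale (a2 * b2) v" and
    w3: "Vector_Spaces.linear scale scale w3" "\<And>v. w3 (w3 v) = scale (a3 + b3) (w3 v) - scale (a3 * b3) v" and
    u: "\<And>v. u v = w1 v + w2 v + w3 v"
    using sum_of_three_quadratics[OF assms(3,2)] assms(4) by metis
  have "poly_endo scale p1 w1 v = 0" "poly_endo scale p2 w2 v = 0" "poly_endo scale p3 w3 v = 0" for v
    using poly_endo_quadratic[OF assms(1) 1 w1(2)] poly_endo_quadratic[OF assms(1) 2 w2(2)]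
      poly_endo_quadratic[OF assms(1) 3 w3(2)] by auto
  then show ?thesis
    unfolding is_poly_sum_def using w1(1) w2(1) w3(1) u
    by (intro exI[of _ "[w1, w2, w3]"]) (auto simp: less_Suc_eq numeral_3_eq_3 add.assoc)
qed

end
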